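(* Consider a decision epoch $e$ of the DOP-rd at which the vehicle is at the depot. Let $\ell$ be the largest number of parcels from $N_e^{unserved}$ that can be delivered within $[t_e,T_E]$. If there exists a subset $N_{sol}\subseteq N_e^{known}$ of parcels that can be delivered within $[t_e,T_E]$ such that $|N_{sol}|=\ell$, then the optimal policy is to leave the depot immediately (at time $t_e$) and distribute the parcels from $N_{sol}$.
   Context: The DOP-rd (Orienteering Problem with Stochastic and Dynamic Release Dates). $G=(V,A)$ is a complete graph, $V=\{0\}\cup N$, where $0$ is the depot and $N$ is the finite set of customers, each with one parcel. Traveling times $d_{ij}>0$ satisfy the triangle inequality. A single uncapacitated vehicle performs routes (tours starting and ending at the depot and visiting customers in between) and must be back at the depot by the deadline $T_E$. The parcel of customer $i$ becomes available at the depot at a random release date; the distributions of release dates are dynamically updated over time. No preemptive return to the depot is allowed: the vehicle comes back only once all parcels on board are delivered. The goal is to maximize the expected number of requests served within $T_E$. Markov Decision Process. Decision epochs are $e\in\{0,\dots,E\}$, with time $t_e$. - At epoch $e$, $N_e^{unserved}$ is the set of customers not yet served. It is partitioned into $N_e^{known}$ (parcel already available at the depot, release date at most $t_e$) and $N_e^{unknown}$ (parcel not yet arrived; its release date is a random variable $\widetilde r_i^e$, and it can only be delivered by a route starting after its arrival). - The state is $S_e=(t_e,N_e^{known},\{\widetilde r_i^e\}_{i\in N_e^{unknown}})$. - An action $\mathcal{X}_e\in X(S_e)$ is the choice of a subset of $N_e^{known}$ together with a TSP (shortest) route serving that subset, which leaves the depot immediately at $t_e$ and must be completed by $T_E$;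 the empty subset means waiting at the depot. - After $\mathcal{X}_e$, the next epoch has time $t_{e+1}=t_e+t_{route}(\mathcal{X}_e)$ if the route is non-empty, where $t_{route}(\mathcal{X}_e)$ is the route duration. Otherwise $t_{e+1}=\min(t_p,t_e+\phi)$, where $t_p$ is the earliest time a new parcel arrives while the vehicle is at the depot and $\phi>0$ is a fixed maximum waiting time. Served customers are removed, and parcels arrived between epochs $e$ and $e+1$ are moved from unknown to known. - The immediate reward $C(S_e,\mathcal{X}_e)$ is the number of requests served by the route of $\mathcal{X}_e$. - The value function satisfies $V_E(S_E)=0$ and $$V_e(S_e)=\max_{\mathcal{X}_e\in X(S_e)}\{C(S_e,\mathcal{X}_e)+\gamma\,\mathbb{E}[V_{e+1}(S_{e+1}\mid S_e,\mathcal{X}_e)]\},$$ where $\gamma\in(0,1]$ is a discount factor ($\gamma=1$ gives the expected number of requests served). A decision rule at $e$ is optimal if it selects an action attaining this maximum. Meaning of "can be delivered within $[t_e,T_E]$". The number $\ell$ is the optimal value of the (deterministic) Orienteering Problem on $N_e^{unserved}$ with all parcel profits equal to one and maximum route duration $T_E-t_e$. That is, $\ell$ is the maximum number of customers of $N_e^{unserved}$ that can be visited by a single route of duration at most $T_E-t_e$, disregarding release dates (all parcels assumed available at the depot). A subset $N_{sol}\subseteq N_e^{known}$ can be delivered within $[t_e,T_E]$ if some single route visiting all customers of $N_{sol}$ has duration at most $T_E-t_e$. *)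

theory Defs
  imports "HOL-Probability.Probability"
begin

(* 'v: vertices.  'w: sample points of the probability space on which the random
   release dates live.  release S i is the random release date of an unknown parcel i;
   its values for i outside unknown S are irrelevant. *)

record ('v, 'w) dop_state =
  time    :: real
  known   :: "'v set"
  unknown :: "'v set"
  release :: "'v \<Rightarrow> 'w \<Rightarrow> real"

(* update e S X \<omega> is the family of random release dates that describes the belief at
   epoch Suc e if action X was taken in state S at epoch e and \<omega> was the outcome. *)

record ('v, 'w) dop_instance =
  depot     :: 'v
  customers :: "'v set"
  dist_time :: "'v \<Rightarrow> 'v \<Rightarrow> real"
  deadline  :: real
  max_wait  :: real
  discount  :: real
  horizon   :: nat
  sample    :: "'w measure"
  update    :: "nat \<Rightarrow> ('v, 'w) dop_state \<Rightarrow> 'v list \<Rightarrow> 'w \<Rightarrow> 'v \<Rightarrow> 'w \<Rightarrow> real"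

definition unserved :: "('v, 'w) dop_state \<Rightarrow> 'v set" where
  "unserved S = known S \<union> unknown S"

(* A route is the list of its customers in visiting order; the depot is implicit at both
   ends.  The empty list stands for staying at the depot. *)

definition is_route :: "('v, 'w) dop_instance \<Rightarrow> 'v list \<Rightarrow> bool" where
  "is_route P xs \<longleftrightarrow> distinct xs \<and> set xs \<subseteq> customers P"

fun path_time :: "('v \<Rightarrow> 'v \<Rightarrow> real) \<Rightarrow> 'v list \<Rightarrow> real" where
  "path_time d (x # y # zs) = d x y + path_time d (y # zs)"
| "path_time d _ = 0"

definition route_time :: "('v, 'w) dop_instance \<Rightarrow> 'v list \<Rightarrow> real" where
  "route_time P xs =
     (if xs = [] then 0 else path_time (dist_time P) (depot P # xs @ [depot P]))"

definition tsp_route :: "('v, 'w) dop_instance \<Rightarrow> 'v set \<Rightarrow> 'v list \<Rightarrow> bool" where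
  "tsp_route P A xs \<longleftrightarrow> is_route P xs \<and> set xs = A \<and>
     (\<forall>ys. is_route P ys \<and> set ys = A \<longrightarrow> route_time P xs \<le> route_time P ys)"

definition can_be_delivered :: "('v, 'w) dop_instance \<Rightarrow> ('v, 'w) dop_state \<Rightarrow> 'v set \<Rightarrow> bool" where
  "can_be_delivered P S A \<longleftrightarrow>
     (\<exists>xs. is_route P xs \<and> A \<subseteq> set xs \<and> route_time P xs \<le> deadline P - time S)"

(* The value is meaningful only for time S \<le> deadline P; otherwise no route fits and the
   set is empty. *)

definition orienteering_opt :: "('v, 'w) dop_instance \<Rightarrow> ('v, 'w) dop_state \<Rightarrow> nat" where
  "orienteering_opt P S =
     Max {card (set xs) | xs. is_route P xs \<and> set xs \<subseteq> unserved S \<and>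
                              route_time P xs \<le> deadline P - time S}"

(* Waiting is always allowed, also when the deadline has passed. *)

definition actions :: "('v, 'w) dop_instance \<Rightarrow> ('v, 'w) dop_state \<Rightarrow> 'v list set" where
  "actions P S = insert []
     {xs. set xs \<subseteq> known S \<and> tsp_route P (set xs) xs \<and> time S + route_time P xs \<le> deadline P}"

definition reward :: "'v list \<Rightarrow> real" where
  "reward X = real (card (set X))"

(* For X = [] this is min t_p (time S + max_wait P), where t_p is the smallest realised
   release date of an unknown parcel (infinite if there is none). *)

definition next_time ::
  "('v, 'w) dop_instance \<Rightarrow> ('v, 'w) dop_state \<Rightarrow> 'v list \<Rightarrow> 'w \<Rightarrow> real" where
  "next_time P S X \<omega> =
     (if X = [] then Min (insert (time S + max_wait P) ((\<lambda>i. release S i \<omega>) ` unknown S))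
      else time S + route_time P X)"

definition arrived ::
  "('v, 'w) dop_instance \<Rightarrow> ('v, 'w) dop_state \<Rightarrow> 'v list \<Rightarrow> 'w \<Rightarrow> 'v set" where
  "arrived P S X \<omega> = {i \<in> unknown S. release S i \<omega> \<le> next_time P S X \<omega>}"

definition next_state ::
  "('v, 'w) dop_instance \<Rightarrow> nat \<Rightarrow> ('v, 'w) dop_state \<Rightarrow> 'v list \<Rightarrow> 'w \<Rightarrow> ('v, 'w) dop_state" where
  "next_state P e S X \<omega> =
     \<lparr> time = next_time P S X \<omega>,
       known = (known S - set X) \<union> arrived P S X \<omega>,
       unknown = unknown S - arrived P S X \<omega>,
       release = update P e S X \<omega> \<rparr>"

definition valid_state :: "('v, 'w) dop_instance \<Rightarrow> ('v, 'w) dop_state \<Rightarrow> bool" where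
  "valid_state P S \<longleftrightarrow>
     known S \<subseteq> customers P \<and> unknown S \<subseteq> customers P \<and> known S \<inter> unknown S = {} \<and>
     (\<forall>i \<in> unknown S. release S i \<in> borel_measurable (sample P) \<and>
                      (AE \<omega> in sample P. time S < release S i \<omega>))"

(* The last assumption only constrains update: after each transition the updated release
   dates of the parcels that are still unknown are random variables with values after the
   new time.  The beliefs may otherwise evolve arbitrarily, and the release dates may be
   dependent.  dist_time need not be symmetric. *)

locale dop_rd =
  fixes P :: "('v, 'w) dop_instance"
  assumes finite_customers: "finite (customers P)"
    and depot_not_customer: "depot P \<notin> customers P"
    and dist_pos: "\<lbrakk>i \<in> insert (depot P) (customers P); j \<in> insert (depot P) (customers P);
                    i \<noteq> j\<rbrakk> \<Longrightarrow> 0 < dist_time P i j"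
    and dist_triangle: "\<lbrakk>i \<in> insert (depot P) (customers P); j \<in> insert (depot P) (customers P);
                    k \<in> insert (depot P) (customers P); i \<noteq> j; j \<noteq> k; i \<noteq> k\<rbrakk>
                    \<Longrightarrow> dist_time P i k \<le> dist_time P i j + dist_time P j k"
    and max_wait_pos: "0 < max_wait P"
    and discount_pos: "0 < discount P"
    and discount_le_1: "discount P \<le> 1"
    and prob_sample: "prob_space (sample P)"
    and update_valid: "\<lbrakk>e < horizon P; valid_state P S; X \<in> actions P S\<rbrakk>
                    \<Longrightarrow> AE \<omega> in sample P. valid_state P (next_state P e S X \<omega>)"

(* Each epoch draws a fresh \<omega>: release S already describes the release dates conditionally
   on everything observed so far, so the integral is the conditional expectation given
   the state and the action.  Measurability of the integrand is not imposed on update; where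
   it fails, the Bochner integral is 0. *)

function opt_value :: "('v, 'w) dop_instance \<Rightarrow> nat \<Rightarrow> ('v, 'w) dop_state \<Rightarrow> real" where
  "opt_value P e S =
     (if horizon P \<le> e then 0
      else Max ((\<lambda>X. reward X +
                     discount P * (\<integral>\<omega>. opt_value P (Suc e) (next_state P e S X \<omega>) \<partial>sample P))
                ` actions P S))"
  by pat_completeness auto
termination
  by (relation "Wellfounded.measure (\<lambda>(P, e, S). horizon P - e)") auto

declare opt_value.simps [simp del]

definition action_value ::
  "('v, 'w) dop_instance \<Rightarrow> nat \<Rightarrow> ('v, 'w) dop_state \<Rightarrow> 'v list \<Rightarrow> real" where
  "action_value P e S X =
     reward X + discount P * (\<integral>\<omega>. opt_value P (Suc e) (next_state P e S X \<omega>) \<partial>sample P)"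

definition optimal_action ::
  "('v, 'w) dop_instance \<Rightarrow> nat \<Rightarrow> ('v, 'w) dop_state \<Rightarrow> 'v list \<Rightarrow> bool" where
  "optimal_action P e S X \<longleftrightarrow> X \<in> actions P S \<and> action_value P e S X = opt_value P e S"

end

(* Since the depot can be skipped by the triangle inequality, the routes that any policy
   performs from epoch e on merge into one route of duration at most the time left.  Hence
   opt_value never exceeds the orienteering optimum, whatever the beliefs do; discounting
   only helps, as rewards are nonnegative.  Leaving with N_sol collects this upper bound
   at once. *)

theory Submission
  imports Defs
begin

lemma path_time_append:
  "path_time d (xs @ a # ys) = path_time d (xs @ [a]) + path_time d (a # ys)"
proof (induction xs)
  case (Cons x xs)
  then show ?case by (cases xs) auto
qed simp

lemma next_state_simps [simp]:
  "time (next_state P e S X \<omega>) = next_time P S X \<omega>"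
  "unserved (next_state P e S X \<omega>) = (known S - set X) \<union> unknown S"
  by (auto simp: next_state_def unserved_def arrived_def)

text \<open>These are the routes over which \<open>orienteering_opt\<close> maximises; release dates
  are ignored. Past the deadline there are none, not even \<open>[]\<close>.\<close>

definition feasible_route :: "('v, 'w) dop_instance \<Rightarrow> ('v, 'w) dop_state \<Rightarrow> 'v list \<Rightarrow> bool" where
  "feasible_route P S xs \<longleftrightarrow>
     is_route P xs \<and> set xs \<subseteq> unserved S \<and> route_time P xs \<le> deadline P - time S"

context dop_rd
begin

lemma finite_routes: "finite {xs. is_route P xs}"
proof -
  have "{xs. is_route P xs} = {xs. set xs \<subseteq> customers P \<and> distinct xs}"
    by (auto simp: is_route_def)
  then show ?thesis
    using finite_subset_distinct[OF finite_customers] by simp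
qed

lemma finite_actions: "finite (actions P S)"
  unfolding actions_def
  by (intro finite.insertI finite_subset[OF _ finite_routes]) (auto simp: tsp_route_def)

text \<open>Skipping \<open>y\<close> replaces the two legs through it by one direct leg. The
  one-customer route is treated apart: both neighbours of \<open>y\<close> are then the depot, and
  \<open>dist_triangle\<close> asks for distinct endpoints.\<close>

lemma route_time_remove:
  assumes "is_route P (xs @ y # zs)"
  shows "route_time P (xs @ zs) \<le> route_time P (xs @ y # zs)"
proof (cases "xs @ zs = []")
  case True
  then show ?thesis
    using assms dist_pos[of "depot P" y] dist_pos[of y "depot P"] depot_not_customer
    by (fastforce simp: is_route_def route_time_def)
next
  case False
  \<comment> \<open>\<open>a\<close> and \<open>b\<close> are the neighbours of \<open>y\<close> on
    the tour, possibly the depot; \<open>L\<close> and \<open>R\<close> are what lies before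
    \<open>a\<close> and after \<open>b\<close>.\<close>
  define L where "L = butlast (depot P # xs)"
  define a where "a = last (depot P # xs)"
  define b where "b = hd (zs @ [depot P])"
  define R where "R = tl (zs @ [depot P])"
  have L: "depot P # xs = L @ [a]" and R: "zs @ [depot P] = b # R"
    by (simp_all add: L_def a_def b_def R_def)
  have a: "a = depot P \<and> xs = [] \<or> a \<in> set xs"
    by (simp add: a_def)
  have b: "b = depot P \<and> zs = [] \<or> b \<in> set zs"
    by (cases zs) (auto simp: b_def)
  have "dist_time P a b \<le> dist_time P a y + dist_time P y b"
    using a b assms False depot_not_customer
    by (intro dist_triangle) (auto simp: is_route_def)
  moreover have "depot P # (xs @ zs) @ [depot P] = L @ a # b # R"
    using L R by (metis append_Cons append_assoc append_Nil)
  moreover have "depot P # (xs @ y # zs) @ [depot P] = L @ a # y # b # R"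
    using L R by (metis append_Cons append_assoc append_Nil)
  ultimately show ?thesis
    using False path_time_append[of "dist_time P" L a "b # R"]
      path_time_append[of "dist_time P" L a "y # b # R"]
    by (auto simp: route_time_def)
qed

lemma route_restrict:
  assumes "is_route P xs" "A \<subseteq> set xs"
  obtains ys where "is_route P ys" "set ys = A" "route_time P ys \<le> route_time P xs"
proof -
  have "\<exists>ys. is_route P ys \<and> set ys = A \<and> route_time P ys \<le> route_time P xs"
    using assms
  proof (induction "length xs" arbitrary: xs rule: less_induct)
    case less
    show ?case
    proof (cases "set xs = A")
      case False
      then obtain y where y: "y \<in> set xs" "y \<notin> A" using less.prems by blast
      then obtain us vs where xs: "xs = us @ y # vs" by (meson split_list)
      have "is_route P (us @ vs)" "A \<subseteq> set (us @ vs)"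
        using less.prems y xs by (auto simp: is_route_def)
      then show ?thesis
        using less.hyps[of "us @ vs"] route_time_remove[of us y vs] less.prems xs
        by fastforce
    qed (use less.prems in blast)
  qed
  then show thesis using that by blast
qed

text \<open>Restricting the route to no customers leaves \<open>[]\<close>, whose duration is
  0.\<close>

lemma route_time_nonneg: "is_route P xs \<Longrightarrow> 0 \<le> route_time P xs"
  by (erule route_restrict[of xs "{}"]) (auto simp: route_time_def)

text \<open>Going directly from the last customer of \<open>xs\<close> to the first of
  \<open>ys\<close> is no longer than the detour via the depot.\<close>

lemma route_time_append:
  assumes "is_route P (xs @ ys)"
  shows "route_time P (xs @ ys) \<le> route_time P xs + route_time P ys"
proof (cases "xs = [] \<or> ys = []")
  case True
  then show ?thesis by (auto simp: route_time_def)
next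
  case False
  then obtain us a b vs where eq: "xs = us @ [a]" "ys = b # vs"
    by (metis rev_exhaust list.exhaust)
  have "dist_time P a b \<le> dist_time P a (depot P) + dist_time P (depot P) b"
    using assms depot_not_customer
    by (intro dist_triangle) (auto simp: is_route_def eq)
  then show ?thesis
    using path_time_append[of "dist_time P" "depot P # us" a "b # vs @ [depot P]"]
      path_time_append[of "dist_time P" "depot P # us" a "[depot P]"]
    by (simp add: route_time_def eq)
qed

lemma ex_tsp_route:
  assumes "is_route P xs"
  shows "\<exists>X. tsp_route P (set xs) X"
proof -
  let ?R = "{ys. is_route P ys \<and> set ys = set xs}"
  have "finite ?R" by (rule finite_subset[OF _ finite_routes]) auto
  moreover have "?R \<noteq> {}" using assms by blast
  ultimately obtain X where "is_arg_min (route_time P) (\<lambda>ys. ys \<in> ?R) X"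
    using ex_is_arg_min_if_finite by blast
  then have "tsp_route P (set xs) X"
    by (auto simp: is_arg_min_linorder tsp_route_def)
  then show ?thesis ..
qed

lemma opt_value_eq:
  assumes "e < horizon P"
  shows "opt_value P e S = Max (action_value P e S ` actions P S)"
  using assms by (subst opt_value.simps) (simp add: action_value_def[abs_def])

text \<open>Waiting is always allowed and has reward 0, so nonnegativity passes backwards from the
  horizon.\<close>

lemma opt_value_nonneg: "0 \<le> opt_value P e S"
proof (induction "horizon P - e" arbitrary: e S)
  case 0
  then show ?case by (simp add: opt_value.simps)
next
  case (Suc n)
  have "0 \<le> action_value P e S []"
    using Suc discount_pos
    by (auto simp: action_value_def reward_def intro!: mult_nonneg_nonneg integral_nonneg)
  also have "\<dots> \<le> opt_value P e S"
    using Suc.hyps(2) finite_actions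
    by (subst opt_value_eq) (auto simp: actions_def intro!: Max_ge)
  finally show ?case .
qed

lemma action_value_ge_reward: "reward X \<le> action_value P e S X"
  using discount_pos
  by (auto simp: action_value_def opt_value_nonneg intro!: mult_nonneg_nonneg integral_nonneg)

lemma next_time_ge:
  assumes "valid_state P S" "X \<in> actions P S"
  shows "AE \<omega> in sample P. time S + route_time P X \<le> next_time P S X \<omega>"
proof (cases "X = []")
  case True
  have fin: "finite (unknown S)"
    using assms finite_customers finite_subset by (auto simp: valid_state_def)
  \<comment> \<open>Finitely many unknown parcels contribute finitely many null sets, so all release
    dates lie after the current time simultaneously, almost surely.\<close>
  have "AE \<omega> in sample P. \<forall>i\<in>unknown S. time S < release S i \<omega>"
    using assms fin by (simp add: AE_finite_all valid_state_def)
  then show ?thesis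
    by eventually_elim
      (use True fin max_wait_pos in \<open>auto simp: next_time_def route_time_def intro: less_imp_le\<close>)
qed (simp add: next_time_def)

text \<open>Merging step: the action and a later route become one route from the present state. They
  share no customer, since served customers leave \<open>known\<close> and \<open>unknown\<close> is
  disjoint from it.\<close>

lemma feasible_route_append:
  assumes "valid_state P S" "X \<in> actions P S"
    and "time S + route_time P X \<le> next_time P S X \<omega>"
    and "feasible_route P (next_state P e S X \<omega>) ys"
  shows "feasible_route P S (X @ ys)" "set X \<inter> set ys = {}"
proof -
  have X: "is_route P X" "set X \<subseteq> known S"
    using assms by (auto simp: actions_def tsp_route_def is_route_def)
  have Y: "is_route P ys" "set ys \<subseteq> (known S - set X) \<union> unknown S"
    "route_time P ys \<le> deadline P - next_time P S X \<omega>"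
    using assms by (auto simp: feasible_route_def)
  show disj: "set X \<inter> set ys = {}"
    using X Y assms(1) by (auto simp: valid_state_def)
  have route: "is_route P (X @ ys)"
    using X Y disj by (auto simp: is_route_def)
  show "feasible_route P S (X @ ys)"
    using route_time_append[OF route] route X Y assms(3)
    by (auto simp: feasible_route_def unserved_def)
qed

text \<open>\<open>[]\<close> is excluded because waiting remains an action after the deadline, when
  no route is feasible.\<close>

lemma feasible_route_action:
  assumes "X \<in> actions P S" "X \<noteq> []"
  shows "feasible_route P S X"
  using assms by (auto simp: actions_def tsp_route_def feasible_route_def unserved_def)

text \<open>The bound \<open>c\<close> is arbitrary so that the induction over the remaining epochs
  can pass \<open>c - reward X\<close> to the successor state. The condition
  \<open>0 \<le> c\<close> covers states past the deadline, where the bound on routes is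
  vacuous.\<close>

lemma opt_value_le:
  assumes "valid_state P S" "0 \<le> c"
    and "\<And>xs. feasible_route P S xs \<Longrightarrow> real (card (set xs)) \<le> c"
  shows "opt_value P e S \<le> c"
  using assms
proof (induction "horizon P - e" arbitrary: e S c)
  case 0
  then show ?case by (simp add: opt_value.simps)
next
  case (Suc n)
  interpret prob_space "sample P" by (rule prob_sample)
  have e: "e < horizon P" using Suc.hyps(2) by simp
  have "action_value P e S X \<le> c" if X: "X \<in> actions P S" for X
  proof -
    let ?V = "\<lambda>\<omega>. opt_value P (Suc e) (next_state P e S X \<omega>)"
    have c: "0 \<le> c - reward X"
      using Suc.prems feasible_route_action[OF X]
      by (cases "X = []") (auto simp: reward_def)
    have "AE \<omega> in sample P. ?V \<omega> \<le> c - reward X"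
      using update_valid[OF e Suc.prems(1) X] next_time_ge[OF Suc.prems(1) X]
    proof eventually_elim
      case (elim \<omega>)
      show ?case
      proof (rule Suc.hyps(1))
        fix ys assume ys: "feasible_route P (next_state P e S X \<omega>) ys"
        note app = feasible_route_append[OF Suc.prems(1) X elim(2) ys]
        show "real (card (set ys)) \<le> c - reward X"
          \<comment> \<open>By disjointness the merged route serves
            \<open>card (set X) + card (set ys)\<close> customers, which is at most
            \<open>c\<close>.\<close>
          using Suc.prems(3)[OF app(1)] app(2) by (simp add: reward_def card_Un_disjoint)
      qed (use Suc.hyps(2) elim c in auto)
    qed
    \<comment> \<open>If \<open>?V\<close> is not integrable, its integral is 0 and the bound is
      just \<open>c\<close>.\<close>
    then have int: "(\<integral>\<omega>. ?V \<omega> \<partial>sample P) \<le> c - reward X"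
      using c integral_le_const[of ?V] not_integrable_integral_eq[of "sample P" ?V] by fastforce
    have "discount P * (\<integral>\<omega>. ?V \<omega> \<partial>sample P) \<le> (\<integral>\<omega>. ?V \<omega> \<partial>sample P)"
      using discount_pos discount_le_1 opt_value_nonneg
      by (intro mult_left_le_one_le) auto
    with int show ?thesis by (simp add: action_value_def)
  qed
  then show ?case
    using finite_actions[of S] by (subst opt_value_eq[OF e]) (auto simp: actions_def)
qed

lemma card_le_orienteering_opt:
  assumes "feasible_route P S xs"
  shows "card (set xs) \<le> orienteering_opt P S"
  unfolding orienteering_opt_def
proof (rule Max_ge)
  have "{card (set xs) |xs. is_route P xs \<and> set xs \<subseteq> unserved S \<and>
           route_time P xs \<le> deadline P - time S} \<subseteq> (card \<circ> set) ` {xs. is_route P xs}"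
    by auto
  then show "finite {card (set xs) |xs. is_route P xs \<and> set xs \<subseteq> unserved S \<and>
           route_time P xs \<le> deadline P - time S}"
    using finite_routes finite_subset by blast
qed (use assms in \<open>auto simp: feasible_route_def\<close>)

text \<open>The chain \<open>reward X\<close> \<le> \<open>action_value P e S X\<close> \<le>
  \<open>opt_value P e S\<close> \<le> \<open>orienteering_opt P S\<close> closes up, so equality
  holds throughout.\<close>

lemma optimal_action_if_reward_eq:
  assumes "e < horizon P" "valid_state P S" "X \<in> actions P S"
    and "reward X = real (orienteering_opt P S)"
  shows "optimal_action P e S X"
proof -
  have "opt_value P e S \<le> reward X"
    using card_le_orienteering_opt assms by (intro opt_value_le) auto
  moreover have "action_value P e S X \<le> opt_value P e S"
    using assms finite_actions by (simp add: opt_value_eq)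
  ultimately show ?thesis
    using action_value_ge_reward[of X e S] assms by (simp add: optimal_action_def)
qed

end

theorem proposition2:
  fixes P :: "('v, 'w) dop_instance"
    and S :: "('v, 'w) dop_state"
    and e :: nat
    and N_sol :: "'v set"
  assumes "dop_rd P"
    and "e < horizon P"
    and "valid_state P S"
    and "N_sol \<subseteq> known S"
    and "can_be_delivered P S N_sol"
    and "card N_sol = orienteering_opt P S"
  shows "(\<exists>X. tsp_route P N_sol X) \<and>
         (\<forall>X. tsp_route P N_sol X \<longrightarrow> optimal_action P e S X)"
proof -
  interpret dop_rd P by fact
  obtain xs where "is_route P xs" "N_sol \<subseteq> set xs" "route_time P xs \<le> deadline P - time S"
    using assms(5) by (auto simp: can_be_delivered_def)
  \<comment> \<open>The witness of \<open>can_be_delivered\<close> may visit customers outside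
    \<open>N_sol\<close>. After restriction it visits exactly \<open>N_sol\<close>, so it bounds the
    duration of every shortest route and keeps it within the deadline.\<close>
  then obtain ys where ys: "is_route P ys" "set ys = N_sol"
    "route_time P ys \<le> deadline P - time S"
    using route_restrict by (metis order_trans)
  have "optimal_action P e S X" if X: "tsp_route P N_sol X" for X
  proof (rule optimal_action_if_reward_eq)
    have "route_time P X \<le> route_time P ys" and "set X = N_sol"
      using X ys by (auto simp: tsp_route_def)
    then show "X \<in> actions P S" "reward X = real (orienteering_opt P S)"
      using X ys assms(4,6) by (auto simp: actions_def reward_def)
  qed (fact assms)+
  then show ?thesis
    using ex_tsp_route[OF ys(1)] ys(2) by auto
qed

end
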